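(* Let $N,n,M\ge 1$ be integers. For each $j\in\{1,\dots,N\}$ let $\mathcal X^j\subseteq\mathbb R^n$ be non-empty, compact and convex, and let $f_\circ^j$ be a function on $\mathbb R^n$ with values in $\mathbb R\cup\{+\infty\}$ such that $f^j:=f_\circ^j+\iota_{\mathcal X^j}:\mathbb R^n\to\mathbb R\cup\{+\infty\}$ is proper, lower semi-continuous and convex. Put $\mathcal X:=\mathcal X^1\times\cdots\times\mathcal X^N$ and $\boldsymbol f(\boldsymbol x):=\sum_{j=1}^N f^j(x^j)$. Let $P_1,\dots,P_M\in\mathbb R^{N\times N}$ be row-stochastic matrices (non-negative entries, each row summing to $1$), each with strictly positive diagonal entries and strongly connected associated digraph. Let $Q_1,\dots,Q_M\in\mathbb R^{N\times N}$ be diagonal positive definite matrices, and for $i\in\{1,\dots,M\}$ put $\boldsymbol A_i:=P_i\otimes I_n$, $\boldsymbol Q_i:=Q_i\otimes I_n$ and $T_i:=\mathrm{prox}_{\boldsymbol f}^{\boldsymbol Q_i}\circ\boldsymbol A_i$. Assume: (1) for each $i$ and each $\boldsymbol x(0)\in\mathcal X$, the (non-switching) iteration $\boldsymbol x(k+1)=T_i(\boldsymbol x(k))$ converges to a point of $\mathrm{fix}(T_i)$; (2) $\mathcal E:=\bigcap_{i=1}^M\mathrm{fix}(T_i)\neq\emptyset$; (3) for each $i$, the operator $T_i$ is linearly regular on $\mathcal H_{\boldsymbol Q_i}$. Then there exists $\bar\tau\in\mathbb N$ such that, for every natural number $\tau\ge\bar\tau$, every switching signal $\sigma:\mathbb N\to\{1,\dots,M\}$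 that has dwell time $\tau$ and takes each value $i\in\{1,\dots,M\}$ infinitely many times, and every $\boldsymbol x(0)\in\mathcal X$, the sequence $(\boldsymbol x(k))_{k=0}^\infty$ generated by $$\boldsymbol x(k+1)=\mathrm{prox}_{\boldsymbol f}^{\boldsymbol Q_{\sigma(k)}}\big(\boldsymbol A_{\sigma(k)}\,\boldsymbol x(k)\big),\qquad k\in\mathbb N,$$ converges to a persistent network equilibrium, i.e. to a point of $\mathcal E$.
   Context: Collective vectors are written $\boldsymbol x=[x^1;\dots;x^N]\in\mathbb R^{nN}$ with $x^j\in\mathbb R^n$. $\iota_{\mathcal C}$ is the indicator function ($0$ on $\mathcal C$, $+\infty$ elsewhere). For a symmetric positive definite matrix $Q$: $\|x\|_Q:=\sqrt{x^\top Qx}$; $\mathcal H_Q$ is the Euclidean space of the corresponding dimension endowed with the inner product $\langle x|y\rangle_Q=x^\top Qy$; $\mathrm d_Q(x,\mathcal C):=\inf_{c\in\mathcal C}\|x-c\|_Q$; and for a proper lower semi-continuous convex $f$, $\mathrm{prox}_f^Q(x):=\mathrm{argmin}_y\, f(y)+\tfrac12\|x-y\|_Q^2$ (a single point). $\mathrm{fix}(T)$ is the set of fixed points of $T$. $\otimes$ is the Kronecker product. Since $Q_i$ is diagonal, $\mathrm{prox}_{\boldsymbol f}^{\boldsymbol Q_i}$ acts separately on each block $x^j$, with weight $(Q_i)_{jj}I_n$. The digraph associated with a matrix $P=[a_{p,q}]\in\mathbb R^{N\times N}$ has nodes $1,\dots,N$, with an edge between $p$ and $q$ (in a fixed direction convention)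 exactly when $a_{p,q}\neq0$. Linear regularity: an operator $T:\mathcal H_Q\to\mathcal H_Q$ with $\mathrm{fix}(T)\ne\emptyset$ is linearly regular if there is $\kappa\ge0$ such that $\mathrm d_Q(x,\mathrm{fix}(T))\le\kappa\,\|x-T(x)\|_Q$ for all $x\in\mathcal H_Q$. Switching times and dwell time: the switching times $\bar k_1<\bar k_2<\cdots$ of $\sigma$ are the times $k\ge1$ with $\sigma(k)\ne\sigma(k-1)$; $\sigma$ has dwell time $\tau\in\mathbb N$ if $\bar k_{l+1}-\bar k_l>\tau$ for all consecutive switching times. A persistent network equilibrium is an element of the set $\mathcal E=\bigcap_{i=1}^M\mathrm{fix}(T_i)$. *)

theory Defs
  imports "Graph_Theory.Graph_Theory" "HOL-Analysis.Analysis"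
begin

section \<open>Extended-real-valued functions\<close>

definition indicator_fun :: "'a set \<Rightarrow> 'a \<Rightarrow> ereal" where
  "indicator_fun C x = (if x \<in> C then 0 else \<infinity>)"

definition proper_fun :: "('a \<Rightarrow> ereal) \<Rightarrow> bool" where
  "proper_fun f \<longleftrightarrow> (\<forall>x. f x \<noteq> -\<infinity>) \<and> (\<exists>x. f x \<noteq> \<infinity>)"

definition lower_semicont :: "('a::topological_space \<Rightarrow> ereal) \<Rightarrow> bool" where
  "lower_semicont f \<longleftrightarrow> (\<forall>x. f x \<le> Liminf (at x) f)"

text \<open>The library constant \<^const>\<open>convex_on\<close> is restricted to real-valued functions.
  The following is only used for functions that do not take the value \<open>-\<infinity>\<close>, so
  the sum on the right is never of the form \<open>\<infinity> - \<infinity>\<close>; recall that \<open>0 * \<infinity> = 0\<close>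
  in \<^typ>\<open>ereal\<close>.\<close>

definition convex_fun :: "('a::real_vector \<Rightarrow> ereal) \<Rightarrow> bool" where
  "convex_fun f \<longleftrightarrow> (\<forall>x y. \<forall>u\<ge>0. \<forall>v\<ge>0. u + v = 1 \<longrightarrow>
     f (u *\<^sub>R x + v *\<^sub>R y) \<le> ereal u * f x + ereal v * f y)"

section \<open>Matrices\<close>

definition row_stochastic :: "real^'k^'k \<Rightarrow> bool" where
  "row_stochastic P \<longleftrightarrow> (\<forall>p q. 0 \<le> P $ p $ q) \<and> (\<forall>p. (\<Sum>q\<in>UNIV. P $ p $ q) = 1)"

definition diagonal_matrix :: "real^'k^'k \<Rightarrow> bool" where
  "diagonal_matrix Q \<longleftrightarrow> (\<forall>p q. p \<noteq> q \<longrightarrow> Q $ p $ q = 0)"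

definition pos_def_matrix :: "real^'k^'k \<Rightarrow> bool" where
  "pos_def_matrix Q \<longleftrightarrow> transpose Q = Q \<and> (\<forall>x. x \<noteq> 0 \<longrightarrow> 0 < x \<bullet> (Q *v x))"

definition matrix_digraph :: "real^'k^'k \<Rightarrow> ('k, 'k \<times> 'k) pre_digraph" where
  "matrix_digraph P = \<lparr>verts = UNIV, arcs = {(p, q). P $ p $ q \<noteq> 0}, tail = fst, head = snd\<rparr>"

text \<open>Collective vectors \<open>[x\<^sup>1; \<dots>; x\<^sup>N]\<close> in \<open>\<real>\<^sup>n\<^sup>N\<close> are elements of
  \<open>real^('N \<times> 'n)\<close>: the entry at \<open>(j, a)\<close> is the \<open>a\<close>-th component of the
  \<open>j\<close>-th block.\<close>

definition kronecker :: "real^'k^'k \<Rightarrow> real^'l^'l \<Rightarrow> real^('k \<times> 'l)^('k \<times> 'l)" where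
  "kronecker A B = (\<chi> r c. A $ fst r $ fst c * B $ snd r $ snd c)"

definition block :: "real^('k::finite \<times> 'l::finite) \<Rightarrow> 'k \<Rightarrow> real^'l" where
  "block x j = (\<chi> a. x $ (j, a))"

definition product_set :: "('k::finite \<Rightarrow> (real^'l) set) \<Rightarrow> (real^('k \<times> 'l)) set" where
  "product_set X = {x. \<forall>j. block x j \<in> X j}"

definition separable_sum :: "('k::finite \<Rightarrow> real^'l \<Rightarrow> ereal) \<Rightarrow> real^('k \<times> 'l) \<Rightarrow> ereal" where
  "separable_sum f x = (\<Sum>j\<in>UNIV. f j (block x j))"

section \<open>The space \<open>\<H>\<^sub>Q\<close> and operators on it\<close>

definition norm_wrt :: "real^'d^'d \<Rightarrow> real^'d \<Rightarrow> real" where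
  "norm_wrt Q x = sqrt (x \<bullet> (Q *v x))"

definition dist_wrt :: "real^'d^'d \<Rightarrow> real^'d \<Rightarrow> (real^'d) set \<Rightarrow> real" where
  "dist_wrt Q x C = (INF c\<in>C. norm_wrt Q (x - c))"

definition prox :: "real^'d^'d \<Rightarrow> (real^'d \<Rightarrow> ereal) \<Rightarrow> real^'d \<Rightarrow> real^'d" where
  "prox Q f x = arg_min (\<lambda>y. f y + ereal (1 / 2 * (norm_wrt Q (x - y))\<^sup>2)) (\<lambda>_. True)"

definition fix_set :: "('a \<Rightarrow> 'a) \<Rightarrow> 'a set" where
  "fix_set T = {x. T x = x}"

definition linearly_regular :: "real^'d^'d \<Rightarrow> (real^'d \<Rightarrow> real^'d) \<Rightarrow> bool" where
  "linearly_regular Q T \<longleftrightarrow> fix_set T \<noteq> {} \<and>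
     (\<exists>\<kappa>\<ge>0. \<forall>x. dist_wrt Q x (fix_set T) \<le> \<kappa> * norm_wrt Q (x - T x))"

section \<open>Switching signals\<close>

definition switching_times :: "(nat \<Rightarrow> 'a) \<Rightarrow> nat set" where
  "switching_times \<sigma> = {k. 1 \<le> k \<and> \<sigma> k \<noteq> \<sigma> (k - 1)}"

definition has_dwell_time :: "(nat \<Rightarrow> 'a) \<Rightarrow> nat \<Rightarrow> bool" where
  "has_dwell_time \<sigma> \<tau> \<longleftrightarrow>
     (\<forall>k\<in>switching_times \<sigma>. \<forall>k'\<in>switching_times \<sigma>.
        k < k' \<and> {k<..<k'} \<inter> switching_times \<sigma> = {} \<longrightarrow> \<tau> < k' - k)"

end

theory Submission
  imports Defs
begin

text \<open>
  In the norm \<open>max\<^sub>j \<parallel>x\<^sup>j\<parallel>\<close> every \<open>T\<^sub>i\<close> is nonexpansive, whatever the weights \<open>Q\<^sub>i\<close>, because it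
  averages the blocks and then applies a firmly nonexpansive map to each of them. Suppose \<open>T\<^sub>i\<^sup>N\<close>
  does not bring \<open>x\<close> closer to a fixed point \<open>w\<close>. By strict convexity of the Euclidean norm, a block
  whose error attains the maximum has the same error vector as all the blocks it averages one
  step earlier. Since the graph is strongly connected with loops, after going back \<open>N - 1\<close> steps all
  blocks share one error vector, both at time 1 and at time 0, so that \<open>T\<^sub>i x = x\<close>. Hence
  \<open>T\<^sub>i\<^sup>N\<close> is paracontracting and the argument of Elsner, Koltracht and Neumann for products of
  paracontractions in arbitrary order applies, with \<open>\<tau>\<^sub>0 = N\<close>.
\<close>

section \<open>Lower semicontinuity and existence of proximal points\<close>

text \<open>Without a minimizer, every \<open>x\<close> in \<open>K\<close> has some
  \<open>c x\<close> in \<open>K\<close> with a smaller value, and \<open>g\<close> stays above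
  \<open>g (c x)\<close> on a neighbourhood \<open>U x\<close>. Finitely many \<open>U x\<close>
  cover \<open>K\<close>. Among their points \<open>c x\<close>, one with least value lies in some
  \<open>U x'\<close>, so \<open>c x'\<close> has a still smaller value.\<close>

lemma lower_semicont_attains_min:
  fixes g :: "'a::topological_space \<Rightarrow> 'b::linorder"
  assumes "compact K" "K \<noteq> {}"
    and lsc: "\<And>x a. x \<in> K \<Longrightarrow> a < g x \<Longrightarrow> eventually (\<lambda>y. a < g y) (nhds x)"
  shows "\<exists>x\<in>K. \<forall>y\<in>K. g x \<le> g y"
proof (rule ccontr)
  assume "\<not> ?thesis"
  then obtain c where c: "\<And>x. x \<in> K \<Longrightarrow> c x \<in> K \<and> g (c x) < g x"
    by (metis not_le)
  have "\<exists>U. open U \<and> x \<in> U \<and> (\<forall>y\<in>U. g (c x) < g y)" if "x \<in> K" for x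
    using lsc[OF that] c[OF that] unfolding eventually_nhds by blast
  then obtain U where U: "\<And>x. x \<in> K \<Longrightarrow> open (U x) \<and> x \<in> U x \<and> (\<forall>y\<in>U x. g (c x) < g y)"
    by metis
  obtain D where D: "D \<subseteq> K" "finite D" "K \<subseteq> (\<Union>x\<in>D. U x)"
    using compactE_image[OF \<open>compact K\<close>, of K U] U by blast
  then have "D \<noteq> {}" using \<open>K \<noteq> {}\<close> by auto
  then obtain x0 where x0: "x0 \<in> D" "\<And>y. y \<in> D \<Longrightarrow> g (c x0) \<le> g (c y)"
    using ex_min_if_finite[of "(\<lambda>x. g (c x)) ` D"] \<open>finite D\<close> by (auto simp: not_less)
  with D c obtain x' where "x' \<in> D" "c x0 \<in> U x'" by blast
  with U D x0 show False by (meson leD subsetD)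
qed

lemma lower_semicont_eventually_greater:
  assumes "lower_semicont f" "a < f x"
  shows "eventually (\<lambda>y. a < f y) (nhds x)"
proof -
  have "a < Liminf (at x) f"
    using assms unfolding lower_semicont_def by (meson less_le_trans)
  then have "eventually (\<lambda>y. a < f y) (at x)" by (rule less_LiminfD)
  then show ?thesis
    using assms(2) by (auto simp: eventually_at_filter elim: eventually_mono)
qed

text \<open>A real threshold \<open>r\<close> is split at some \<open>b\<close> with
  \<open>r - h x < b < f x\<close>: near \<open>x\<close>, \<open>f\<close> stays above
  \<open>b\<close> and \<open>h\<close> stays above \<open>r - b\<close>.\<close>

lemma lower_semicont_add_continuous:
  fixes h :: "'a::t2_space \<Rightarrow> real"
  assumes f: "lower_semicont f" "\<And>x. f x \<noteq> -\<infinity>" and h: "isCont h x"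
    and a: "a < f x + ereal (h x)"
  shows "eventually (\<lambda>y. a < f y + ereal (h y)) (nhds x)"
proof (cases a)
  case (real r)
  have "ereal (r - h x) < f x"
    using a real by (cases "f x") auto
  then obtain b where b: "r - h x < b" "ereal b < f x"
    using ereal_dense2 by (metis ereal_less(1) less_ereal.simps(1))
  have "eventually (\<lambda>y. ereal b < f y) (nhds x)"
    by (rule lower_semicont_eventually_greater) fact+
  moreover have "(h \<longlongrightarrow> h x) (nhds x)"
    using h by (simp add: isCont_def tendsto_at_iff_tendsto_nhds)
  then have "eventually (\<lambda>y. r - b < h y) (nhds x)"
    using b by (intro order_tendstoD(1)) auto
  ultimately show ?thesis
  proof eventually_elim
    case (elim y)
    then show ?case using real by (cases "f y") auto
  qed
next
  case MInf
  have "-\<infinity> < f y + ereal (h y)" for y using f(2)[of y] by (cases "f y") auto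
  then show ?thesis using MInf by simp
qed (use a in auto)

text \<open>The minimum over the compact set \<open>K\<close> is global because the objective is
  infinite outside \<open>K\<close>.\<close>

lemma prox_objective_attains_min:
  fixes f :: "'a::euclidean_space \<Rightarrow> ereal"
  assumes "compact K" "K \<noteq> {}" "\<And>y. y \<notin> K \<Longrightarrow> f y = \<infinity>"
    and f: "proper_fun f" "lower_semicont f"
  shows "\<exists>p. \<forall>y. f p + ereal (w / 2 * (norm (u - p))\<^sup>2) \<le> f y + ereal (w / 2 * (norm (u - y))\<^sup>2)"
proof -
  let ?g = "\<lambda>y. f y + ereal (w / 2 * (norm (u - y))\<^sup>2)"
  have "\<exists>p\<in>K. \<forall>y\<in>K. ?g p \<le> ?g y"
  proof (rule lower_semicont_attains_min)
    fix x a assume "x \<in> K" "a < ?g x"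
    then show "eventually (\<lambda>y. a < ?g y) (nhds x)"
      using f by (intro lower_semicont_add_continuous) (auto simp: proper_fun_def)
  qed fact+
  then obtain p where "\<forall>y\<in>K. ?g p \<le> ?g y" by auto
  then have "?g p \<le> ?g y" for y
    using assms(3)[of y] by (cases "y \<in> K") auto
  then show ?thesis by blast
qed

section \<open>Variational inequality and firm nonexpansiveness\<close>

text \<open>First-order optimality without derivatives: compare \<open>p\<close> with the points of
  the segment from \<open>p\<close> to \<open>y\<close>, divide by the step length and let it tend
  to 0.\<close>

lemma prox_point_variational:
  fixes f :: "'a::euclidean_space \<Rightarrow> ereal"
  assumes f: "proper_fun f" "convex_fun f"
    and p: "\<And>y. f p + ereal (w / 2 * (norm (u - p))\<^sup>2) \<le> f y + ereal (w / 2 * (norm (u - y))\<^sup>2)"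
  shows "\<exists>r. f p = ereal r \<and> (\<forall>y s. f y = ereal s \<longrightarrow> w * ((u - p) \<bullet> (y - p)) \<le> s - r)"
proof -
  obtain y0 where "f y0 \<noteq> \<infinity>" using f by (auto simp: proper_fun_def)
  moreover have ninf: "f y \<noteq> -\<infinity>" for y using f by (auto simp: proper_fun_def)
  ultimately have "f p \<noteq> \<infinity>"
    using p[of y0] by (cases "f y0") auto
  with ninf obtain r where r: "f p = ereal r" by (cases "f p") auto
  have "w * ((u - p) \<bullet> (y - p)) \<le> s - r" if s: "f y = ereal s" for y s
  proof -
    \<comment> \<open>Convexity bounds \<open>f\<close> at \<open>?z\<close>, and the penalty is
      quadratic in \<open>t\<close>; dividing by \<open>t\<close> leaves an error of order
      \<open>t\<close>, which vanishes in the limit taken below.\<close>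
    have *: "w * ((u - p) \<bullet> (y - p)) \<le> s - r + t * (w / 2 * (norm (y - p))\<^sup>2)" if t: "0 < t" "t < 1" for t
    proof -
      let ?z = "(1 - t) *\<^sub>R p + t *\<^sub>R y"
      have "f ?z \<le> ereal (1 - t) * f p + ereal t * f y"
        using f(2) t unfolding convex_fun_def by (metis add.commute diff_add_cancel diff_ge_0_iff_ge less_imp_le)
      then have "f ?z \<le> ereal ((1 - t) * r + t * s)" by (simp add: r s)
      then obtain q where q: "f ?z = ereal q" "q \<le> (1 - t) * r + t * s"
        using ninf[of ?z] by (cases "f ?z") auto
      have "r + w / 2 * (norm (u - p))\<^sup>2 \<le> q + w / 2 * (norm (u - ?z))\<^sup>2"
        using p[of ?z] by (simp add: q r)
      moreover have "(norm (u - ?z))\<^sup>2 = (norm (u - p))\<^sup>2 - 2 * t * ((u - p) \<bullet> (y - p)) + t\<^sup>2 * (norm (y - p))\<^sup>2"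
      proof -
        have expand: "(norm (a - t *\<^sub>R b))\<^sup>2 = (norm a)\<^sup>2 - 2 * t * (a \<bullet> b) + t\<^sup>2 * (norm b)\<^sup>2" for a b :: 'a
          unfolding power2_norm_eq_inner
          by (simp add: inner_diff_left inner_diff_right inner_commute algebra_simps power2_eq_square)
        have "u - ?z = (u - p) - t *\<^sub>R (y - p)" by (simp add: algebra_simps)
        then show ?thesis by (simp only: expand)
      qed
      ultimately have "r + w / 2 * (norm (u - p))\<^sup>2 \<le> q + w / 2 *
          ((norm (u - p))\<^sup>2 - 2 * t * ((u - p) \<bullet> (y - p)) + t\<^sup>2 * (norm (y - p))\<^sup>2)"
        by simp
      then have "t * (w * ((u - p) \<bullet> (y - p))) \<le> q - r + w / 2 * (t\<^sup>2 * (norm (y - p))\<^sup>2)"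
        by (simp only: ring_distribs) (simp add: mult_ac)
      also have "\<dots> \<le> t * (s - r + t * (w / 2 * (norm (y - p))\<^sup>2))"
        using q(2) by (simp add: ring_distribs power2_eq_square mult_ac)
      finally have "t * (w * ((u - p) \<bullet> (y - p))) \<le> t * (s - r + t * (w / 2 * (norm (y - p))\<^sup>2))" .
      then show ?thesis using t(1) by (simp only: mult_le_cancel_left_pos)
    qed
    have "((\<lambda>t. s - r + t * (w / 2 * (norm (y - p))\<^sup>2)) \<longlongrightarrow> s - r + 0 * (w / 2 * (norm (y - p))\<^sup>2)) (at_right 0)"
      by (intro tendsto_intros)
    then have "w * ((u - p) \<bullet> (y - p)) \<le> s - r + 0 * (w / 2 * (norm (y - p))\<^sup>2)"
    proof (rule tendsto_lowerbound)
      show "eventually (\<lambda>t. w * ((u - p) \<bullet> (y - p)) \<le> s - r + t * (w / 2 * (norm (y - p))\<^sup>2)) (at_right 0)"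
        unfolding eventually_at_right_field using * by (intro exI[of _ 1]) auto
    qed simp
    then show ?thesis by simp
  qed
  with r show ?thesis by blast
qed

text \<open>Each proximal point is a test point in the variational inequality of the other. On
  adding, the values of \<open>f\<close> cancel; dividing by the common weight \<open>w\<close>
  bounds the square of \<open>norm (p - p')\<close> by the inner product of \<open>p - p'\<close>
  and \<open>u - u'\<close>. Expanding the squares turns this into the claim, from which
  \<open>w\<close> has disappeared.\<close>

lemma prox_points_firmly_nonexpansive:
  fixes f :: "'a::euclidean_space \<Rightarrow> ereal"
  assumes f: "proper_fun f" "convex_fun f" and w: "0 < w"
    and p: "\<And>y. f p + ereal (w / 2 * (norm (u - p))\<^sup>2) \<le> f y + ereal (w / 2 * (norm (u - y))\<^sup>2)"
    and p': "\<And>y. f p' + ereal (w / 2 * (norm (u' - p'))\<^sup>2) \<le> f y + ereal (w / 2 * (norm (u' - y))\<^sup>2)"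
  shows "(norm (p - p'))\<^sup>2 + (norm ((p - p') - (u - u')))\<^sup>2 \<le> (norm (u - u'))\<^sup>2"
proof -
  obtain r where r: "f p = ereal r" "\<And>y s. f y = ereal s \<Longrightarrow> w * ((u - p) \<bullet> (y - p)) \<le> s - r"
    using prox_point_variational[OF f p] by blast
  obtain r' where r': "f p' = ereal r'" "\<And>y s. f y = ereal s \<Longrightarrow> w * ((u' - p') \<bullet> (y - p')) \<le> s - r'"
    using prox_point_variational[OF f p'] by blast
  have "w * ((u - p) \<bullet> (p' - p) + (u' - p') \<bullet> (p - p')) \<le> 0"
    using r(2)[OF r'(1)] r'(2)[OF r(1)] by (simp add: distrib_left)
  then have "(u - p) \<bullet> (p' - p) + (u' - p') \<bullet> (p - p') \<le> 0"
    using w by (simp add: mult_le_0_iff)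
  then show ?thesis
    by (simp add: power2_norm_eq_inner inner_diff_left inner_diff_right inner_commute algebra_simps)
qed

section \<open>Equality in averages and propagation along the graph\<close>

text \<open>The weighted variance about the mean \<open>s\<close> equals the mean of the squared
  norms minus the square of \<open>norm s\<close>. It is at most
  \<open>c\<^sup>2 - c\<^sup>2\<close>, so each term of positive weight vanishes.\<close>

lemma convex_combination_extreme:
  fixes v :: "'i \<Rightarrow> 'a::real_inner"
  assumes "finite I" and a: "\<And>l. l \<in> I \<Longrightarrow> 0 \<le> a l" "(\<Sum>l\<in>I. a l) = 1"
    and v: "\<And>l. l \<in> I \<Longrightarrow> norm (v l) \<le> c" and c: "c \<le> norm (\<Sum>l\<in>I. a l *\<^sub>R v l)" "0 \<le> c"
    and l: "l \<in> I" "a l \<noteq> 0"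
  shows "v l = (\<Sum>l\<in>I. a l *\<^sub>R v l)"
proof -
  define s where "s = (\<Sum>l\<in>I. a l *\<^sub>R v l)"
  have "(\<Sum>l\<in>I. a l * (norm (v l - s))\<^sup>2)
      = (\<Sum>l\<in>I. a l * (norm (v l))\<^sup>2) - 2 * ((\<Sum>l\<in>I. a l *\<^sub>R v l) \<bullet> s) + (\<Sum>l\<in>I. a l) * (norm s)\<^sup>2"
    by (simp add: power2_norm_eq_inner inner_diff_left inner_diff_right inner_commute
        sum.distrib sum_subtractf sum_distrib_left sum_distrib_right inner_sum_right algebra_simps)
  also have "\<dots> = (\<Sum>l\<in>I. a l * (norm (v l))\<^sup>2) - (norm s)\<^sup>2"
    by (simp add: a(2) s_def[symmetric] power2_norm_eq_inner)
  also have "(\<Sum>l\<in>I. a l * (norm (v l))\<^sup>2) \<le> (\<Sum>l\<in>I. a l * c\<^sup>2)"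
    using a v by (intro sum_mono mult_left_mono power_mono) auto
  also have "\<dots> = c\<^sup>2" using a(2) by (simp add: sum_distrib_right[symmetric])
  also have "c\<^sup>2 \<le> (norm s)\<^sup>2" using c by (intro power_mono) (auto simp: s_def)
  finally have "(\<Sum>l\<in>I. a l * (norm (v l - s))\<^sup>2) \<le> 0" by simp
  moreover have "a l * (norm (v l - s))\<^sup>2 \<le> (\<Sum>l\<in>I. a l * (norm (v l - s))\<^sup>2)"
    using \<open>finite I\<close> a l by (intro member_le_sum) auto
  ultimately have "a l * (norm (v l - s))\<^sup>2 \<le> 0" by simp
  then have "v l = s"
    using a(1)[OF l(1)] l(2) by (simp add: mult_le_0_iff)
  then show ?thesis by (simp add: s_def)
qed

text \<open>Loops make the sets \<open>S s\<close> increase, and strong connectivity supplies an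
  edge leaving \<open>S s\<close> until it is everything. Each step thus gains at least one node,
  and CARD('k) - 1 steps suffice from a single node.\<close>

lemma spreading_reaches_all:
  fixes P :: "real^'k^'k" and S :: "nat \<Rightarrow> 'k set"
  assumes P: "strongly_connected (matrix_digraph P)" "\<And>p. P $ p $ p \<noteq> 0"
    and "j \<in> S 0"
    and step: "\<And>s l l'. s < m \<Longrightarrow> l \<in> S s \<Longrightarrow> P $ l $ l' \<noteq> 0 \<Longrightarrow> l' \<in> S (Suc s)"
    and s: "s \<le> m" "CARD('k) \<le> Suc s"
  shows "S s = UNIV"
proof -
  have "j \<in> S s \<and> min (Suc s) CARD('k) \<le> card (S s)" if "s \<le> m" for s
    using that
  proof (induction s)
    case 0
    then have "0 < card (S 0)" using \<open>j \<in> S 0\<close> by (auto simp: card_gt_0_iff)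
    then show ?case using \<open>j \<in> S 0\<close> by auto
  next
    case (Suc s)
    have sub: "S s \<subseteq> S (Suc s)" using step[of s] P(2) Suc by auto
    show ?case
    proof (cases "S s = UNIV")
      case True
      then show ?thesis using sub by (simp add: top_unique)
    next
      case False
      then obtain l where l: "l \<notin> S s" by blast
      have "j \<in> S s" using Suc by simp
      have "(j, l) \<in> rtrancl_on UNIV {(p, q). P $ p $ q \<noteq> 0}"
        using P(1) unfolding strongly_connected_def reachable_def arcs_ends_conv matrix_digraph_def
        by (simp add: image_def)
      \<comment> \<open>A path from \<open>j\<close> inside \<open>S s\<close> to \<open>l\<close>
        outside must cross the boundary of \<open>S s\<close> along some edge.\<close>
      then have "\<exists>q q'. q \<in> S s \<and> q' \<notin> S s \<and> P $ q $ q' \<noteq> 0"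
        using l
      proof (induction rule: rtrancl_on_induct)
        case base then show ?case using \<open>j \<in> S s\<close> by simp
      next
        case (step y z) then show ?case by blast
      qed
      then obtain q q' where "q \<in> S s" "q' \<notin> S s" "q' \<in> S (Suc s)"
        using step[of s] Suc by auto
      then have "card (S s) < card (S (Suc s))"
        using sub by (intro psubset_card_mono) auto
      then show ?thesis using Suc sub by auto
    qed
  qed
  from this[OF s(1)] s(2) have "CARD('k) \<le> card (S s)" by simp
  then show ?thesis by (simp add: card_seteq)
qed

section \<open>Block structure and the proximal map of a separable sum\<close>

lemma block_diff: "block (x - y) j = block x j - block y j"
  by (simp add: block_def vec_eq_iff)

lemma block_eq_iff: "x = y \<longleftrightarrow> (\<forall>j. block x j = block y j)"
  by (simp add: block_def vec_eq_iff split_paired_all)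

lemma inner_blocks: "x \<bullet> y = (\<Sum>j\<in>UNIV. block x j \<bullet> block y j)"
proof -
  have "x \<bullet> y = (\<Sum>r\<in>UNIV \<times> UNIV. x $ r * y $ r)" by (simp add: inner_vec_def)
  also have "\<dots> = (\<Sum>j\<in>UNIV. \<Sum>a\<in>UNIV. x $ (j, a) * y $ (j, a))"
    by (simp only: sum.cartesian_product case_prod_unfold prod.collapse)
  also have "\<dots> = (\<Sum>j\<in>UNIV. block x j \<bullet> block y j)"
    by (simp add: inner_vec_def block_def)
  finally show ?thesis .
qed

lemma norm_blocks_squared: "(norm x)\<^sup>2 = (\<Sum>j\<in>UNIV. (norm (block x j))\<^sup>2)"
  by (simp add: power2_norm_eq_inner inner_blocks[of x])

lemma block_kronecker_mat_1:
  "block (kronecker P (mat 1) *v x) j = (\<Sum>l\<in>UNIV. P $ j $ l *\<^sub>R block x l)"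
proof -
  have "(kronecker P (mat 1) *v x) $ (j, a) = (\<Sum>l\<in>UNIV. P $ j $ l * x $ (l, a))" for a
  proof -
    have "(kronecker P (mat 1) *v x) $ (j, a)
        = (\<Sum>r\<in>UNIV \<times> UNIV. P $ j $ fst r * (if a = snd r then 1 else 0) * x $ r)"
      by (simp add: matrix_vector_mult_def kronecker_def mat_def)
    also have "\<dots> = (\<Sum>l\<in>UNIV. \<Sum>b\<in>UNIV. P $ j $ l * (if a = b then 1 else 0) * x $ (l, b))"
      by (simp only: sum.cartesian_product case_prod_unfold prod.collapse)
    also have "\<dots> = (\<Sum>l\<in>UNIV. \<Sum>b\<in>UNIV. if a = b then P $ j $ l * x $ (l, b) else 0)"
      by (intro sum.cong) auto
    finally show ?thesis by simp
  qed
  then show ?thesis by (simp add: block_def vec_eq_iff)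
qed

lemma pos_def_matrix_diagonal_entry_pos:
  assumes "pos_def_matrix Q"
  shows "0 < Q $ j $ j"
proof -
  have "axis j (1::real) \<noteq> 0" by (simp add: axis_eq_0_iff)
  then have "0 < axis j 1 \<bullet> (Q *v axis j 1)"
    using assms unfolding pos_def_matrix_def by blast
  then show ?thesis by (simp add: matrix_vector_mult_basis inner_axis' column_def)
qed

lemma norm_wrt_kronecker_diagonal:
  assumes "diagonal_matrix Q" "\<And>j. 0 \<le> Q $ j $ j"
  shows "(norm_wrt (kronecker Q (mat 1)) x)\<^sup>2 = (\<Sum>j\<in>UNIV. Q $ j $ j * (norm (block x j))\<^sup>2)"
proof -
  have "block (kronecker Q (mat 1) *v x) j = Q $ j $ j *\<^sub>R block x j" for j
  proof -
    have "(\<Sum>l\<in>UNIV. Q $ j $ l *\<^sub>R block x l) = (\<Sum>l\<in>UNIV. if j = l then Q $ j $ l *\<^sub>R block x l else 0)"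
      using assms(1) by (intro sum.cong) (auto simp: diagonal_matrix_def)
    then show ?thesis by (simp add: block_kronecker_mat_1)
  qed
  then have "x \<bullet> (kronecker Q (mat 1) *v x) = (\<Sum>j\<in>UNIV. Q $ j $ j * (norm (block x j))\<^sup>2)"
    by (simp add: inner_blocks[of x] power2_norm_eq_inner)
  moreover have "\<dots> \<ge> 0" using assms(2) by (simp add: sum_nonneg)
  ultimately show ?thesis by (simp add: norm_wrt_def)
qed

text \<open>\<open>prox\<close> is a Hilbert choice, so nothing is known of it before a minimizer
  exists. One is glued together from minimizers of the single blocks; its value is finite, so no
  minimizer can be worse in any block.\<close>

lemma prox_separable_sum_block_minimizes:
  fixes f :: "'N::finite \<Rightarrow> real^'n \<Rightarrow> ereal" and u :: "real^('N \<times> 'n)"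
  assumes Q: "diagonal_matrix Q" "pos_def_matrix Q"
    and X: "\<And>j. compact (X j)" "\<And>j. X j \<noteq> {}" "\<And>j y. y \<notin> X j \<Longrightarrow> f j y = \<infinity>"
    and f: "\<And>j. proper_fun (f j)" "\<And>j. lower_semicont (f j)"
  defines "p \<equiv> prox (kronecker Q (mat 1)) (separable_sum f) u"
  shows "f j (block p j) + ereal (Q $ j $ j / 2 * (norm (block u j - block p j))\<^sup>2)
    \<le> f j y + ereal (Q $ j $ j / 2 * (norm (block u j - y))\<^sup>2)"
proof -
  define g where "g j y = f j y + ereal (Q $ j $ j / 2 * (norm (block u j - y))\<^sup>2)" for j y
  define F where "F y = separable_sum f y
    + ereal (1 / 2 * (norm_wrt (kronecker Q (mat 1)) (u - y))\<^sup>2)" for y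
  have ninf: "f j y \<noteq> -\<infinity>" for j y using f(1) by (auto simp: proper_fun_def)
  have F: "F y = (\<Sum>j\<in>UNIV. g j (block y j))" for y
  proof -
    have "1 / 2 * (norm_wrt (kronecker Q (mat 1)) (u - y))\<^sup>2
        = (\<Sum>j\<in>UNIV. Q $ j $ j / 2 * (norm (block u j - block y j))\<^sup>2)"
      using Q pos_def_matrix_diagonal_entry_pos[of Q]
      by (simp add: norm_wrt_kronecker_diagonal less_imp_le sum_distrib_left sum_divide_distrib block_diff)
    then show ?thesis
      by (simp only: F_def g_def separable_sum_def sum.distrib sum_ereal)
  qed
  have "\<exists>z. \<forall>y. g j z \<le> g j y" for j
    unfolding g_def using X f by (intro prox_objective_attains_min[of "X j"]) auto
  then obtain z where z: "\<And>j y. g j (z j) \<le> g j y" by metis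
  define Z where "Z = (\<chi> r. z (fst r) $ snd r)"
  have Z: "block Z j = z j" for j by (simp add: Z_def block_def vec_eq_iff)
  have "F Z \<le> F y" for y unfolding F Z using z by (intro sum_mono)
  then have "is_arg_min F (\<lambda>_. True) Z" by (simp add: is_arg_min_linorder)
  then have "is_arg_min F (\<lambda>_. True) p"
    unfolding p_def prox_def F_def[symmetric] arg_min_def by (rule someI)
  then have "F p \<le> F Z" by (simp add: is_arg_min_linorder)
  \<comment> \<open>Finiteness is what keeps the strict inequality in block \<open>j\<close> strict
    after the other blocks have been added.\<close>
  have fin: "\<bar>g l (z l)\<bar> \<noteq> \<infinity>" for l
  proof -
    obtain y where "f l y \<noteq> \<infinity>" using f(1) by (auto simp: proper_fun_def)
    then have "g l y \<noteq> \<infinity>" by (cases "f l y") (auto simp: g_def)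
    then have "g l (z l) \<noteq> \<infinity>" using z[of l y] by auto
    moreover have "g l (z l) \<noteq> -\<infinity>" using ninf[of l "z l"] by (cases "f l (z l)") (auto simp: g_def)
    ultimately show ?thesis by auto
  qed
  have "g j (block p j) \<le> g j (z j)"
  proof (rule ccontr)
    assume "\<not> ?thesis"
    then have less: "g j (z j) < g j (block p j)" by simp
    define R R' where "R = (\<Sum>l\<in>UNIV - {j}. g l (z l))" and "R' = (\<Sum>l\<in>UNIV - {j}. g l (block p l))"
    have "R \<le> R'" unfolding R_def R'_def using z by (intro sum_mono)
    moreover have "R = ereal (\<Sum>l\<in>UNIV - {j}. real_of_ereal (g l (z l)))"
      using fin unfolding R_def by (simp add: ereal_real' flip: sum_ereal)
    ultimately have "g j (z j) + R < g j (block p j) + R'"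
      using less by (cases "g j (z j)"; cases "g j (block p j)"; cases R') auto
    moreover have "F Z = g j (z j) + R" "F p = g j (block p j) + R'"
      unfolding F Z R_def R'_def by (rule sum.remove; simp)+
    ultimately show False using \<open>F p \<le> F Z\<close> by simp
  qed
  also note z[of j y]
  finally show ?thesis by (simp add: g_def)
qed

section \<open>The maximum distance over blocks\<close>

definition block_dist :: "real^('k::finite \<times> 'l::finite) \<Rightarrow> real^('k \<times> 'l) \<Rightarrow> real" where
  "block_dist x y = (MAX j. norm (block x j - block y j))"

lemma norm_block_le_block_dist: "norm (block x j - block y j) \<le> block_dist x y"
  unfolding block_dist_def by (rule Max_ge) auto

lemma block_dist_le_iff: "block_dist x y \<le> b \<longleftrightarrow> (\<forall>j. norm (block x j - block y j) \<le> b)"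
  unfolding block_dist_def by (subst Max_le_iff) auto

lemma block_dist_attained: "\<exists>j. block_dist x y = norm (block x j - block y j)"
proof -
  have "block_dist x y \<in> range (\<lambda>j. norm (block x j - block y j))"
    unfolding block_dist_def by (rule Max_in) auto
  then show ?thesis by auto
qed

lemma block_dist_nonneg: "0 \<le> block_dist x y"
  using norm_block_le_block_dist[of x undefined y] norm_ge_zero order_trans by blast

lemma block_dist_self: "block_dist x x = 0"
  using block_dist_attained[of x x] by auto

lemma block_dist_triangle: "block_dist x z \<le> block_dist x y + block_dist y z"
  unfolding block_dist_le_iff
proof
  fix j
  have "norm (block x j - block z j) \<le> norm (block x j - block y j) + norm (block y j - block z j)"
    using norm_triangle_ineq[of "block x j - block y j" "block y j - block z j"] by simp
  then show "norm (block x j - block z j) \<le> block_dist x y + block_dist y z"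
    using norm_block_le_block_dist[of x j y] norm_block_le_block_dist[of y j z] by simp
qed

text \<open>The factor 1 gives the bound the shape \<open>B * dist x y\<close> in which the
  convergence theorem expects it.\<close>

lemma block_dist_le_dist: "block_dist x y \<le> 1 * dist x y"
  unfolding block_dist_le_iff
proof
  fix j
  have "(norm (block (x - y) j))\<^sup>2 \<le> (norm (x - y))\<^sup>2"
    unfolding norm_blocks_squared[of "x - y"]
    by (rule member_le_sum[where f = "\<lambda>j. (norm (block (x - y) j))\<^sup>2"]) auto
  then have "norm (block (x - y) j) \<le> norm (x - y)" by (rule power2_le_imp_le) simp
  then show "norm (block x j - block y j) \<le> 1 * dist x y" by (simp add: block_diff dist_norm)
qed

lemma dist_le_block_dist:
  fixes x y :: "real^('k::finite \<times> 'l::finite)"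
  shows "dist x y \<le> sqrt CARD('k) * block_dist x y"
proof -
  have "(norm (x - y))\<^sup>2 \<le> (\<Sum>j\<in>(UNIV::'k set). (block_dist x y)\<^sup>2)"
    unfolding norm_blocks_squared[of "x - y"] block_diff
    by (intro sum_mono power_mono norm_block_le_block_dist) simp
  then have "(norm (x - y))\<^sup>2 \<le> (sqrt CARD('k) * block_dist x y)\<^sup>2"
    by (simp add: power_mult_distrib)
  then show ?thesis
    unfolding dist_norm by (rule power2_le_imp_le) (simp add: block_dist_nonneg)
qed

section \<open>Averaging followed by blockwise firmly nonexpansive maps\<close>

text \<open>This retains from the proximal construction only what the contraction argument uses: in
  each block \<open>T\<close> is firmly nonexpansive relative to the averages formed with
  \<open>P\<close>. Neither the functions nor the weights occur any more.\<close>

locale consensus_operator =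
  fixes P :: "real^'N^'N" and T :: "real^('N::finite \<times> 'n::finite) \<Rightarrow> real^('N \<times> 'n)"
  assumes stochastic: "row_stochastic P"
    and firm: "(norm (block (T x) j - block (T y) j))\<^sup>2
      + (norm (block (T x) j - block (T y) j - (\<Sum>l\<in>UNIV. P $ j $ l *\<^sub>R (block x l - block y l))))\<^sup>2
      \<le> (norm (\<Sum>l\<in>UNIV. P $ j $ l *\<^sub>R (block x l - block y l)))\<^sup>2"
begin

lemma norm_block_le_average:
  "norm (block (T x) j - block (T y) j) \<le> norm (\<Sum>l\<in>UNIV. P $ j $ l *\<^sub>R (block x l - block y l))"
proof (rule power2_le_imp_le)
  show "(norm (block (T x) j - block (T y) j))\<^sup>2 \<le> (norm (\<Sum>l\<in>UNIV. P $ j $ l *\<^sub>R (block x l - block y l)))\<^sup>2"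
    using firm[of x j y] by (rule order_trans[rotated]) simp
qed simp

lemma norm_average_le:
  "norm (\<Sum>l\<in>UNIV. P $ j $ l *\<^sub>R (block x l - block y l)) \<le> block_dist x y"
proof -
  have "norm (\<Sum>l\<in>UNIV. P $ j $ l *\<^sub>R (block x l - block y l)) \<le> (\<Sum>l\<in>UNIV. P $ j $ l * block_dist x y)"
    using stochastic
    by (intro sum_norm_le) (simp add: row_stochastic_def mult_left_mono norm_block_le_block_dist)
  also have "\<dots> = block_dist x y"
    using stochastic by (simp add: row_stochastic_def sum_distrib_right[symmetric])
  finally show ?thesis .
qed

lemma nonexpansive: "block_dist (T x) (T y) \<le> block_dist x y"
  unfolding block_dist_le_iff using norm_block_le_average norm_average_le order_trans by blast

lemma power_nonexpansive:
  assumes "T w = w"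
  shows "block_dist ((T ^^ n) x) w \<le> block_dist x w"
proof (induction n)
  case (Suc n)
  then show ?case using nonexpansive[of "(T ^^ n) x" w] assms by simp
qed simp

text \<open>The norms of the new error and of the averaged error \<open>?s\<close> are squeezed to
  equal \<open>c\<close>. The second square in \<open>firm\<close> then vanishes, so the new error
  is \<open>?s\<close>, and equality in the convex combination makes each contributing block error
  equal to \<open>?s\<close>. A general bound \<open>c\<close> allows the same value along a whole
  orbit.\<close>

lemma neighbours_agree:
  assumes w: "T w = w" and c: "block_dist x w \<le> c" "c \<le> norm (block (T x) j - block w j)"
    and l: "P $ j $ l \<noteq> 0"
  shows "block x l - block w l = block (T x) j - block w j"
proof -
  let ?s = "\<Sum>l\<in>UNIV. P $ j $ l *\<^sub>R (block x l - block w l)"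
  have le: "norm (block (T x) j - block w j) \<le> norm ?s"
    using norm_block_le_average[of x j w] w by simp
  have "norm ?s \<le> norm (block (T x) j - block w j)"
    using norm_average_le[of j x w] c by simp
  then have "(norm ?s)\<^sup>2 \<le> (norm (block (T x) j - block w j))\<^sup>2"
    by (intro power_mono) auto
  then have "(norm (block (T x) j - block w j - ?s))\<^sup>2 \<le> 0"
    using firm[of x j w] unfolding w by linarith
  then have "block (T x) j - block w j = ?s" by simp
  moreover have "block x l - block w l = ?s"
  proof (rule convex_combination_extreme[where c = c])
    show "c \<le> norm ?s" using c le by simp
    show "0 \<le> c" using c(1) block_dist_nonneg[of x w] by simp
    show "norm (block x l - block w l) \<le> c" for l
      using norm_block_le_block_dist[of x l w] c(1) by simp
  qed (use stochastic l in \<open>auto simp: row_stochastic_def\<close>)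
  ultimately show ?thesis by simp
qed

lemma power_card_paracontracting:
  assumes connected: "strongly_connected (matrix_digraph P)" and diag: "\<And>p. 0 < P $ p $ p"
    and w: "T w = w" and x: "T x \<noteq> x"
  shows "block_dist ((T ^^ CARD('N)) x) w < block_dist x w"
proof (rule ccontr)
  let ?m = "CARD('N)"
  assume "\<not> ?thesis"
  then have ge: "block_dist x w \<le> block_dist ((T ^^ ?m) x) w" by simp
  obtain j where j: "block_dist ((T ^^ ?m) x) w = norm (block ((T ^^ ?m) x) j - block w j)"
    using block_dist_attained by blast
  define v where "v = block ((T ^^ ?m) x) j - block w j"
  \<comment> \<open>The index runs backwards in time: \<open>S s\<close> collects the blocks with
    error \<open>v\<close> at time \<open>?m - s\<close>, so that edges of \<open>P\<close> lead
    from \<open>S s\<close> into \<open>S (Suc s)\<close>.\<close>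
  define S where "S s = {l. block ((T ^^ (?m - s)) x) l - block w l = v}" for s
  have step: "l' \<in> S (Suc s)" if "s < ?m" "l \<in> S s" "P $ l $ l' \<noteq> 0" for s l l'
  proof -
    obtain t where t: "?m - s = Suc t" "?m - Suc s = t" using \<open>s < ?m\<close> by (metis Suc_diff_Suc)
    have v: "block (T ((T ^^ t) x)) l - block w l = v" using that(2) t by (simp add: S_def)
    have "block ((T ^^ t) x) l' - block w l' = block (T ((T ^^ t) x)) l - block w l"
    proof (rule neighbours_agree[OF w power_nonexpansive[OF w] _ that(3)])
      \<comment> \<open>The initial distance is the bound \<open>c\<close> at every time: it
        dominates all iterates, and \<open>v\<close> has at least this norm.\<close>
      show "block_dist x w \<le> norm (block (T ((T ^^ t) x)) l - block w l)"
        using ge j by (simp add: v v_def)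
    qed
    then show ?thesis using v t by (simp add: S_def)
  qed
  have "S s = UNIV" if "s \<le> ?m" "?m \<le> Suc s" for s
    using connected _ _ step that
  proof (rule spreading_reaches_all)
    show "P $ p $ p \<noteq> 0" for p using diag[of p] by simp
    show "j \<in> S 0" by (simp add: S_def v_def)
  qed
  \<comment> \<open>Spreading is complete after \<open>?m - 1\<close> steps, at time 1, and holds at
    time 0 as well. Comparing these two times shows that \<open>x\<close> is fixed, which is why the
    power is CARD('N) and not one less.\<close>
  then have "S ?m = UNIV" "S (?m - 1) = UNIV" by auto
  moreover have "?m - (?m - 1) = 1"
    using zero_less_card_finite[where 'a = 'N] by linarith
  ultimately have "block x l - block w l = v" "block (T x) l - block w l = v" for l
    unfolding S_def by auto
  then have "block (T x) l = block x l" for l by (metis diff_add_cancel)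
  then show False using x by (simp add: block_eq_iff)
qed

end

section \<open>Dwell time and convergence under switching\<close>

text \<open>A change of \<open>\<sigma>\<close> inside the window would yield a first switching time
  \<open>k\<close> after \<open>l\<close>. Then \<open>l\<close> and \<open>k\<close> are
  consecutive, but at most \<open>\<tau>\<close> apart.\<close>

lemma dwell_time_constant_window:
  assumes "has_dwell_time \<sigma> \<tau>" "m \<le> \<tau>" "l \<in> switching_times \<sigma>" "s \<le> m"
  shows "\<sigma> (l + s) = \<sigma> l"
proof (rule ccontr)
  assume ne: "\<sigma> (l + s) \<noteq> \<sigma> l"
  have "\<exists>k. k \<in> switching_times \<sigma> \<and> l < k \<and> k \<le> l + s"
    using ne
  proof (induction s)
    case (Suc s)
    show ?case
    proof (cases "\<sigma> (l + s) = \<sigma> l")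
      case True
      then have "l + Suc s \<in> switching_times \<sigma>" using Suc.prems by (simp add: switching_times_def)
      then show ?thesis by (intro exI[of _ "l + Suc s"]) simp
    next
      case False
      then show ?thesis using Suc.IH le_SucI by fastforce
    qed
  qed simp
  then obtain k' where k': "k' \<in> switching_times \<sigma> \<and> l < k'" "k' \<le> l + s" by blast
  define k where "k = (LEAST k. k \<in> switching_times \<sigma> \<and> l < k)"
  have k: "k \<in> switching_times \<sigma> \<and> l < k" unfolding k_def by (rule LeastI[where P = "\<lambda>k. k \<in> switching_times \<sigma> \<and> l < k", OF k'(1)])
  have "k \<le> k'" unfolding k_def by (rule Least_le[where P = "\<lambda>k. k \<in> switching_times \<sigma> \<and> l < k", OF k'(1)])
  have "i \<notin> switching_times \<sigma>" if "l < i" "i < k" for i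
    using not_less_Least[OF that(2)[unfolded k_def]] that(1) by simp
  then have "{l<..<k} \<inter> switching_times \<sigma> = {}" by auto
  with k assms(1,3) have "\<tau> < k - l" unfolding has_dwell_time_def by blast
  then show False using \<open>k \<le> k'\<close> k'(2) assms(2,4) by simp
qed

text \<open>Take a cluster point \<open>z\<close> of the iterates at times that start a constant
  window. If some operator moved \<open>z\<close>, wait for the first one to do so: the iterate is
  then still close to \<open>z\<close>, and \<open>m\<close> applications of that operator bring it
  closer to \<open>w\<close> than \<open>z\<close> is. This contradicts the monotone decrease of the
  distance to \<open>w\<close>.\<close>

theorem switched_paracontractions_converge:
  fixes T :: "'i::finite \<Rightarrow> 'a::heine_borel \<Rightarrow> 'a" and d :: "'a \<Rightarrow> 'a \<Rightarrow> real"
  assumes d: "\<And>x y z. d x z \<le> d x y + d y z" "\<And>x. d x x = 0"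
      "\<And>x y. d x y \<le> B * dist x y" "\<And>x y. dist x y \<le> C * d x y" "0 < C"
    and nonexpansive: "\<And>i x y. d (T i x) (T i y) \<le> d x y"
    and paracontracting: "\<And>i x w. T i w = w \<Longrightarrow> T i x \<noteq> x \<Longrightarrow> d ((T i ^^ m) x) w < d x w"
    and equilibrium: "(\<Inter>i. fix_set (T i)) \<noteq> {}"
    and \<sigma>: "has_dwell_time \<sigma> \<tau>" "m \<le> \<tau>" "\<And>i. infinite {k. \<sigma> k = i}"
    and x: "\<And>k. x (Suc k) = T (\<sigma> k) (x k)"
  shows "\<exists>l\<in>(\<Inter>i. fix_set (T i)). x \<longlonglongrightarrow> l"
proof -
  have nonneg: "0 \<le> d u v" for u v
  proof -
    have "0 \<le> C * d u v" using d(4)[of u v] zero_le_dist[of u v] by linarith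
    then show ?thesis using d(5) by (simp add: zero_le_mult_iff)
  qed
  \<comment> \<open>Only the operators applied between \<open>k\<close> and \<open>k + s\<close>
    have to fix the point, so this also serves for \<open>z\<close> before \<open>z\<close> is known
    to be a common fixed point.\<close>
  have mono: "d (x (k + s)) w \<le> d (x k) w" if "\<And>t. t < s \<Longrightarrow> T (\<sigma> (k + t)) w = w" for k s w
    using that
  proof (induction s)
    case (Suc s)
    have "d (x (k + Suc s)) w = d (T (\<sigma> (k + s)) (x (k + s))) (T (\<sigma> (k + s)) w)"
      using Suc.prems[of s] by (simp add: x)
    also have "\<dots> \<le> d (x (k + s)) w" by (rule nonexpansive)
    also have "\<dots> \<le> d (x k) w" using Suc by simp
    finally show ?case .
  qed simp
  have tendsto_d: "((\<lambda>n. d (y n) w) \<longlongrightarrow> d z w) F" if "(y \<longlongrightarrow> z) F" for y :: "'b \<Rightarrow> 'a" and z w F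
  proof -
    have "((\<lambda>n. B * dist (y n) z) \<longlongrightarrow> 0) F"
      using tendsto_mult[OF tendsto_const[of B] that[THEN tendsto_dist_iff[THEN iffD1]]] by simp
    moreover have *: "\<bar>d (y n) w - d z w\<bar> \<le> B * dist (y n) z" for n
      using d(1)[of "y n" w z] d(1)[of z w "y n"] d(3)[of "y n" z] d(3)[of z "y n"]
      unfolding dist_commute[of z "y n"] by linarith
    have "((\<lambda>n. d (y n) w - d z w) \<longlongrightarrow> 0) F"
      by (rule Lim_null_comparison[OF _ calculation]) (simp add: *)
    then show ?thesis by (rule LIM_zero_cancel)
  qed
  have d_tendsto: "(y \<longlongrightarrow> z) F" if "((\<lambda>n. d (y n) z) \<longlongrightarrow> 0) F" for y :: "'b \<Rightarrow> 'a" and z F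
  proof -
    have lim: "((\<lambda>n. C * d (y n) z) \<longlongrightarrow> 0) F"
      using tendsto_mult[OF tendsto_const[of C] that] by simp
    have "((\<lambda>n. dist (y n) z) \<longlongrightarrow> 0) F"
      by (rule Lim_null_comparison[OF _ lim]) (simp add: d(4))
    then show ?thesis by (rule tendsto_dist_iff[THEN iffD2])
  qed
  have nonexpansive_pow: "d ((T i ^^ n) y) ((T i ^^ n) z) \<le> d y z" for i n y z
  proof (induction n)
    case (Suc n)
    then show ?case using nonexpansive[of i "(T i ^^ n) y" "(T i ^^ n) z"] by simp
  qed simp
  define G where "G = {k. \<forall>s\<le>m. \<sigma> (k + s) = \<sigma> k}"
  have switch_G: "k \<in> G" if "k \<in> switching_times \<sigma>" for k
    using dwell_time_constant_window[OF \<sigma>(1,2) that] by (simp add: G_def)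
  have G_step: "x (k + m) = (T (\<sigma> k) ^^ m) (x k)" if "k \<in> G" for k
  proof -
    have "x (k + s) = (T (\<sigma> k) ^^ s) (x k)" if "s \<le> m" for s
      using that
    proof (induction s)
      case (Suc s)
      have "\<sigma> (k + s) = \<sigma> k" using \<open>k \<in> G\<close> Suc by (simp add: G_def)
      then show ?case using Suc by (simp add: x)
    qed simp
    then show ?thesis by simp
  qed
  \<comment> \<open>Either a switching time follows \<open>k0\<close>, or the signal is constant
    from \<open>k0\<close> on; the latter can occur when there is only one operator.\<close>
  have "\<exists>k\<ge>k0. k \<in> G" for k0
  proof (cases "\<exists>k\<ge>k0. k \<in> switching_times \<sigma>")
    case True then show ?thesis using switch_G by blast
  next
    case False
    have "\<sigma> (k0 + s) = \<sigma> k0" for s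
    proof (induction s)
      case (Suc s)
      have "k0 + Suc s \<notin> switching_times \<sigma>" using False by simp
      then show ?case using Suc by (simp add: switching_times_def)
    qed simp
    then have "k0 \<in> G" unfolding G_def by blast
    then show ?thesis by blast
  qed
  then have "infinite G" by (simp add: infinite_nat_iff_unbounded_le)
  then obtain e :: "nat \<Rightarrow> nat" where e: "strict_mono e" "\<And>n. e n \<in> G"
    using infinite_enumerate[of G] by auto
  obtain w where w: "\<And>i. T i w = w" using equilibrium by (auto simp: fix_set_def)
  have "dist (x k) w \<le> C * d (x 0) w" for k
  proof -
    have "C * d (x k) w \<le> C * d (x 0) w" using mono[where k = 0 and s = k] w d(5) by simp
    then show ?thesis using d(4)[of "x k" w] by linarith
  qed
  then have "bounded (range (x \<circ> e))"
    by (intro bounded_subset[OF bounded_cball[of w "C * d (x 0) w"]]) (auto simp: dist_commute)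
  then obtain z r where r: "strict_mono r" "((x \<circ> e) \<circ> r) \<longlonglongrightarrow> z"
    using bounded_imp_convergent_subsequence by blast
  define g where "g = e \<circ> r"
  have g: "\<And>n. g n \<in> G" "\<And>n. n \<le> g n" "(\<lambda>n. x (g n)) \<longlonglongrightarrow> z"
    using e(2) r(2) strict_mono_imp_increasing[OF strict_mono_o[OF e(1) r(1)]]
    by (simp_all add: g_def o_def)
  \<comment> \<open>The distances to \<open>w\<close> decrease along the whole sequence and converge
    to \<open>d z w\<close> along \<open>g\<close>.\<close>
  have above: "d z w \<le> d (x k) w" for k
  proof (rule tendsto_upperbound[OF tendsto_d[OF g(3)]])
    show "eventually (\<lambda>n. d (x (g n)) w \<le> d (x k) w) sequentially"
      using eventually_ge_at_top[of k]
    proof eventually_elim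
      case (elim n)
      then have "k \<le> g n" using g(2)[of n] by simp
      then show ?case using mono[of "g n - k" k w] w by simp
    qed
  qed simp
  have z: "T i z = z" for i
  proof (rule ccontr)
    assume i: "T i z \<noteq> z"
    \<comment> \<open>\<open>L n\<close> is the first time from \<open>g n\<close> on whose operator
      moves \<open>z\<close>; it exists because the index \<open>i\<close> recurs.\<close>
    define L where "L n = (LEAST l. g n \<le> l \<and> T (\<sigma> l) z \<noteq> z)" for n
    have "\<exists>l. g n \<le> l \<and> T (\<sigma> l) z \<noteq> z" for n
    proof -
      from \<sigma>(3)[of i] obtain l where "g n \<le> l" "\<sigma> l = i" unfolding infinite_nat_iff_unbounded_le by auto
      with i show ?thesis by auto
    qed
    then have "g n \<le> L n \<and> T (\<sigma> (L n)) z \<noteq> z" for n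
      unfolding L_def by (rule LeastI_ex)
    then have L: "g n \<le> L n" "T (\<sigma> (L n)) z \<noteq> z" for n
      by blast+
    have L_min: "T (\<sigma> l) z = z" if "g n \<le> l" "l < L n" for l n
      using not_less_Least[of l] that unfolding L_def by blast
    \<comment> \<open>If \<open>L n\<close> is later than \<open>g n\<close>, the preceding operator
      fixes \<open>z\<close> and the one at \<open>L n\<close> does not, so the signal switches
      there. If they coincide, the choice of \<open>g n\<close> in \<open>G\<close> guarantees the
      full window.\<close>
    have L_G: "L n \<in> G" for n
    proof (cases "L n = g n")
      case False
      then have "T (\<sigma> (L n - 1)) z = z" using L(1)[of n] by (intro L_min[of n]) auto
      with L(2)[of n] False L(1)[of n] have "L n \<in> switching_times \<sigma>"
        by (auto simp: switching_times_def)
      then show ?thesis by (rule switch_G)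
    qed (use g in simp)
    have L_le: "d (x (L n)) z \<le> d (x (g n)) z" for n
      using mono[of "L n - g n" "g n" z] L(1)[of n] L_min[of n] by simp
    have "(\<lambda>n. d (x (g n)) z) \<longlonglongrightarrow> 0"
      using tendsto_d[OF g(3), of z] d(2) by simp
    from _ _ tendsto_const this have lim: "(\<lambda>n. d (x (L n)) z) \<longlonglongrightarrow> 0"
      by (rule tendsto_sandwich) (simp_all add: nonneg L_le)
    \<comment> \<open>The index \<open>\<sigma> (L n)\<close> varies with \<open>n\<close>, so the
      strict decrease is obtained for each \<open>j\<close> separately and then for all of the
      finitely many \<open>j\<close> at once.\<close>
    have "eventually (\<lambda>n. T j z \<noteq> z \<longrightarrow> d ((T j ^^ m) (x (L n))) w < d z w) sequentially" for j
    proof (cases "T j z = z")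
      case False
      have "(\<lambda>n. d ((T j ^^ m) (x (L n))) ((T j ^^ m) z)) \<longlonglongrightarrow> 0"
        by (rule tendsto_sandwich[OF _ _ tendsto_const lim]) (simp_all add: nonneg nonexpansive_pow)
      then have "(\<lambda>n. d ((T j ^^ m) (x (L n))) w) \<longlonglongrightarrow> d ((T j ^^ m) z) w"
        by (rule tendsto_d[OF d_tendsto])
      then have "eventually (\<lambda>n. d ((T j ^^ m) (x (L n))) w < d z w) sequentially"
        using paracontracting[OF w False] by (rule order_tendstoD(2))
      then show ?thesis by (rule eventually_mono) simp
    qed simp
    then have "eventually (\<lambda>n. \<forall>j. T j z \<noteq> z \<longrightarrow> d ((T j ^^ m) (x (L n))) w < d z w) sequentially"
      by (rule eventually_all_finite)
    then obtain n where "\<And>j. T j z \<noteq> z \<Longrightarrow> d ((T j ^^ m) (x (L n))) w < d z w"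
      unfolding eventually_sequentially by blast
    from this[OF L(2)[of n]] show False
      using above[of "L n + m"] by (simp add: G_step[OF L_G])
  qed
  \<comment> \<open>Now \<open>z\<close> is a common fixed point, so the distance to
    \<open>z\<close> is monotone and smallness at a single \<open>g n\<close> persists.\<close>
  have "(\<lambda>k. d (x k) z) \<longlonglongrightarrow> 0"
  proof (rule LIMSEQ_I)
    fix \<epsilon> :: real assume "0 < \<epsilon>"
    have "(\<lambda>n. d (x (g n)) z) \<longlonglongrightarrow> 0"
      using tendsto_d[OF g(3), of z] d(2) by simp
    then obtain n where n: "norm (d (x (g n)) z - 0) < \<epsilon>"
      using LIMSEQ_D[OF _ \<open>0 < \<epsilon>\<close>] by blast
    have "norm (d (x k) z - 0) < \<epsilon>" if "g n \<le> k" for k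
      using nonneg[of "x k" z] mono[of "k - g n" "g n" z] z n that by simp
    then show "\<exists>no. \<forall>k\<ge>no. norm (d (x k) z - 0) < \<epsilon>" by blast
  qed
  then have "x \<longlonglongrightarrow> z" by (rule d_tendsto)
  then show ?thesis using z by (auto simp: fix_set_def)
qed

section \<open>Application to the proximal consensus operators\<close>

theorem theorem1:
  fixes X :: "'N::finite \<Rightarrow> (real^'n) set"
    and f_o f :: "'N \<Rightarrow> real^'n \<Rightarrow> ereal"
    and P Q :: "'M::finite \<Rightarrow> real^'N^'N"
    and A QQ :: "'M \<Rightarrow> real^('N \<times> 'n)^('N \<times> 'n)"
    and T :: "'M \<Rightarrow> real^('N \<times> 'n) \<Rightarrow> real^('N \<times> 'n)"
    and E :: "(real^('N \<times> 'n)) set"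
  defines "f \<equiv> \<lambda>j y. f_o j y + indicator_fun (X j) y"
    and "A \<equiv> \<lambda>i. kronecker (P i) (mat 1)"
    and "QQ \<equiv> \<lambda>i. kronecker (Q i) (mat 1)"
    and "T \<equiv> \<lambda>i. prox (QQ i) (separable_sum f) \<circ> (\<lambda>x. A i *v x)"
    and "E \<equiv> (\<Inter>i. fix_set (T i))"
  assumes X: "\<And>j. X j \<noteq> {} \<and> compact (X j) \<and> convex (X j)"
    and f_o: "\<And>j y. f_o j y \<noteq> -\<infinity>"
    and f: "\<And>j. proper_fun (f j) \<and> lower_semicont (f j) \<and> convex_fun (f j)"
    and P: "\<And>i. row_stochastic (P i)" "\<And>i p. P i $ p $ p > 0"
      "\<And>i. strongly_connected (matrix_digraph (P i))"
    and Q: "\<And>i. diagonal_matrix (Q i) \<and> pos_def_matrix (Q i)"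
    and convergence: "\<And>i x. x 0 \<in> product_set X \<Longrightarrow> (\<And>k. x (Suc k) = T i (x k)) \<Longrightarrow>
      \<exists>l\<in>fix_set (T i). x \<longlonglongrightarrow> l"
    and equilibrium: "E \<noteq> {}"
    and regular: "\<And>i. linearly_regular (QQ i) (T i)"
  shows "\<exists>\<tau>0::nat. \<forall>\<tau>\<ge>\<tau>0. \<forall>\<sigma>::nat \<Rightarrow> 'M. has_dwell_time \<sigma> \<tau> \<longrightarrow>
    (\<forall>i. infinite {k. \<sigma> k = i}) \<longrightarrow>
    (\<forall>x. x 0 \<in> product_set X \<longrightarrow>
      (\<forall>k. x (Suc k) = prox (QQ (\<sigma> k)) (separable_sum f) (A (\<sigma> k) *v x k)) \<longrightarrow>
      (\<exists>l\<in>E. x \<longlonglongrightarrow> l))"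
\<comment> \<open>The dwell time only has to cover the number of applications after which each
  operator is paracontracting.\<close>
proof (rule exI[of _ "CARD('N)"], intro allI impI)
  fix \<tau> and \<sigma> :: "nat \<Rightarrow> 'M" and x
  assume \<sigma>: "CARD('N) \<le> \<tau>" "has_dwell_time \<sigma> \<tau>" "\<forall>i. infinite {k. \<sigma> k = i}"
    and x: "\<forall>k. x (Suc k) = prox (QQ (\<sigma> k)) (separable_sum f) (A (\<sigma> k) *v x k)"
  have outside: "f j y = \<infinity>" if "y \<notin> X j" for j y
    using that f_o[of j y] by (simp add: f_def indicator_fun_def)
  have T: "consensus_operator (P i) (T i)" for i
  proof
    show "row_stochastic (P i)" by fact
    fix x y :: "real^('N \<times> 'n)" and j
    have minimal: "f j (block (T i x) j)
          + ereal (Q i $ j $ j / 2 * (norm (block (A i *v x) j - block (T i x) j))\<^sup>2)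
        \<le> f j z + ereal (Q i $ j $ j / 2 * (norm (block (A i *v x) j - z))\<^sup>2)" for x z
      unfolding T_def QQ_def comp_def
      using Q X f outside by (intro prox_separable_sum_block_minimizes[where X = X]) auto
    have average: "block (A i *v x) j - block (A i *v y) j
        = (\<Sum>l\<in>UNIV. P i $ j $ l *\<^sub>R (block x l - block y l))"
      by (simp add: A_def block_kronecker_mat_1 sum_subtractf scaleR_diff_right)
    \<comment> \<open>For a fixed block both proximal problems carry the same scalar weight
      \<open>Q i $ j $ j\<close>, so it cancels and all operators become nonexpansive in one common
      distance.\<close>
    have "0 < Q i $ j $ j" using Q pos_def_matrix_diagonal_entry_pos by blast
    with f have "(norm (block (T i x) j - block (T i y) j))\<^sup>2
        + (norm (block (T i x) j - block (T i y) j - (block (A i *v x) j - block (A i *v y) j)))\<^sup>2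
        \<le> (norm (block (A i *v x) j - block (A i *v y) j))\<^sup>2"
      by (intro prox_points_firmly_nonexpansive[where f = "f j", OF _ _ _ minimal minimal]) auto
    then show "(norm (block (T i x) j - block (T i y) j))\<^sup>2
        + (norm (block (T i x) j - block (T i y) j - (\<Sum>l\<in>UNIV. P i $ j $ l *\<^sub>R (block x l - block y l))))\<^sup>2
        \<le> (norm (\<Sum>l\<in>UNIV. P i $ j $ l *\<^sub>R (block x l - block y l)))\<^sup>2"
      by (simp only: average)
  qed
  show "\<exists>l\<in>E. x \<longlonglongrightarrow> l"
    unfolding E_def
  proof (rule switched_paracontractions_converge[OF block_dist_triangle block_dist_self
        block_dist_le_dist dist_le_block_dist])
    show "block_dist (T i y) (T i z) \<le> block_dist y z" for i y z
      using T by (rule consensus_operator.nonexpansive)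
    show "block_dist ((T i ^^ CARD('N)) y) w < block_dist y w" if "T i w = w" "T i y \<noteq> y" for i y w
      using T P(3,2) that by (rule consensus_operator.power_card_paracontracting)
    show "x (Suc k) = T (\<sigma> k) (x k)" for k
      using x by (simp add: T_def)
  qed (use \<sigma> equilibrium E_def in auto)
qed

end
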